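(* Let $n\ge 2$. The cardinality of the set of diffeomorphism classes of open smooth $n$-manifolds is at least that of the continuum.
   Context: An open manifold is a connected, noncompact smooth manifold without boundary. *)

theory Defs
  imports "HOL-Analysis.Analysis" "HOL-Library.Equipollence"
begin

(* C^k and C^infinity maps, meant for open S only: the derivatives are full derivatives "at x".
   All iterated directional derivatives up to order k exist, are differentiable below order k,
   and are continuous on S. *)

primrec Ck_on :: "nat \<Rightarrow> 'a::real_normed_vector set \<Rightarrow> ('a \<Rightarrow> 'b::real_normed_vector) \<Rightarrow> bool" where
  "Ck_on 0 S f \<longleftrightarrow> continuous_on S f"
| "Ck_on (Suc k) S f \<longleftrightarrow>
     (\<forall>x\<in>S. f differentiable (at x)) \<and>
     (\<forall>v. Ck_on k S (\<lambda>x. frechet_derivative f (at x) v))"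

definition smooth_on :: "'a::real_normed_vector set \<Rightarrow> ('a \<Rightarrow> 'b::real_normed_vector) \<Rightarrow> bool" where
  "smooth_on S f \<longleftrightarrow> (\<forall>k. Ck_on k S f)"

(* A chart (U, \<phi>) is a total function \<phi> of which only the restriction to U matters. *)

type_synonym ('a, 'e) chart = "'a set \<times> ('a \<Rightarrow> 'e)"

definition is_chart :: "'a topology \<Rightarrow> ('a, 'e::euclidean_space) chart \<Rightarrow> bool" where
  "is_chart X = (\<lambda>(U, \<phi>). openin X U \<and> open (\<phi> ` U) \<and>
     homeomorphic_map (subtopology X U) (top_of_set (\<phi> ` U)) \<phi>)"

definition smoothly_compatible :: "('a, 'e::euclidean_space) chart \<Rightarrow> ('a, 'e) chart \<Rightarrow> bool" where
  "smoothly_compatible = (\<lambda>(U, \<phi>) (V, \<psi>).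
     smooth_on (\<phi> ` (U \<inter> V)) (\<psi> \<circ> inv_into U \<phi>) \<and>
     smooth_on (\<psi> ` (U \<inter> V)) (\<phi> \<circ> inv_into V \<psi>))"

definition smooth_atlas :: "'a topology \<Rightarrow> ('a, 'e::euclidean_space) chart set \<Rightarrow> bool" where
  "smooth_atlas X A \<longleftrightarrow>
     (\<forall>c\<in>A. is_chart X c) \<and>
     \<Union> (fst ` A) = topspace X \<and>
     (\<forall>c\<in>A. \<forall>d\<in>A. smoothly_compatible c d)"

(* A smooth manifold without boundary, modelled on 'e (its dimension is DIM('e)), is given by its
   topology and a smooth atlas. The atlas need not be maximal: atlases defining the same smooth
   structure give manifolds that are diffeomorphic by the identity, hence the same class below. *)

type_synonym ('a, 'e) pre_manifold = "'a topology \<times> ('a, 'e) chart set"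

definition smooth_manifold :: "('a, 'e::euclidean_space) pre_manifold \<Rightarrow> bool" where
  "smooth_manifold = (\<lambda>(X, A). Hausdorff_space X \<and> second_countable X \<and> smooth_atlas X A)"

(* A compact_space need not be nonempty, so noncompactness already excludes the empty space
   (which counts as a connected_space). *)

definition open_manifold :: "('a, 'e::euclidean_space) pre_manifold \<Rightarrow> bool" where
  "open_manifold M \<longleftrightarrow> smooth_manifold M \<and> connected_space (fst M) \<and> \<not> compact_space (fst M)"

definition smooth_map ::
  "('a, 'e::euclidean_space) pre_manifold \<Rightarrow> ('b, 'f::euclidean_space) pre_manifold \<Rightarrow> ('a \<Rightarrow> 'b) \<Rightarrow> bool"
where
  "smooth_map = (\<lambda>(X, A) (Y, B) f. continuous_map X Y f \<and>
     (\<forall>(U, \<phi>)\<in>A. \<forall>(V, \<psi>)\<in>B.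
        smooth_on (\<phi> ` {x \<in> U. f x \<in> V}) (\<psi> \<circ> f \<circ> inv_into U \<phi>)))"

definition diffeomorphic ::
  "('a, 'e::euclidean_space) pre_manifold \<Rightarrow> ('b, 'f::euclidean_space) pre_manifold \<Rightarrow> bool"
where
  "diffeomorphic M N \<longleftrightarrow> (\<exists>f g. smooth_map M N f \<and> smooth_map N M g \<and>
     (\<forall>x\<in>topspace (fst M). g (f x) = x) \<and> (\<forall>y\<in>topspace (fst N). f (g y) = y))"

(* The diffeomorphism classes of open manifolds whose points are drawn from the type 'a. As a
   second countable manifold has at most continuum many points, every open manifold is represented
   as soon as 'a has at least the cardinality of the continuum. *)

definition open_manifold_diffeo_classes :: "('a, 'e::euclidean_space) pre_manifold set set" where
  "open_manifold_diffeo_classes =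
     {M. open_manifold M} // {(M, N). open_manifold M \<and> open_manifold N \<and> diffeomorphic M N}"

end

theory Submission
  imports Defs
begin

text \<open>The manifolds are complements of compact sets on a line in Euclidean space, and they are told
apart by their spaces of ends.

Let \<open>C\<close> be a compact set without intervals on a line in a Euclidean space of dimension at least two.
Its complement is open, connected and noncompact. The one-point compactification of Euclidean space
arises from this complement by adding the points of \<open>C\<close> and infinity, and it does so in a way that
only depends on the topology of the complement: each added point has small neighbourhoods that stay
connected without the added points and whose frontiers avoid these points
(\<open>end_compactification_line_set\<close>). Therefore a homeomorphism between two such complements extends to
the compactifications and restricts to a homeomorphism of the sets of added points
(\<open>homeomorphic_complements_imp_homeomorphic_ends\<close>). A diffeomorphism is a homeomorphism, so it is enough
to find continuum many pairwise non-homeomorphic spaces of ends.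

Countable spaces of ends are of no use for this, as they form only \<open>\<aleph>\<^sub>1\<close> homeomorphism classes.
For a set \<open>S\<close> of natural numbers, attach to a Cantor set, for each \<open>m\<close> in \<open>S\<close>, a sequence of
scattered points of Cantor-Bendixson rank \<open>m\<close> that converges to a point of the Cantor set. Then \<open>S\<close> can
be recovered: it consists of the \<open>n\<close> such that some point is a limit of points of rank \<open>n\<close> but is
not in the closure of the points of rank \<open>n + 1\<close> (\<open>CB_spectrum_ranked\<close>). The result is a compact
subset of the Cantor set, hence it embeds in a line; one of its isolated points is sent to infinity
(\<open>ranked_homeomorphic_ends\<close>).\<close>

section \<open>Extending homeomorphisms to ends\<close>

text \<open>The points of \<open>P\<close> play the role of the ends of \<open>topspace X -
P\<close>. That \<open>W - P\<close> is connected says that \<open>P\<close> does not separate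
\<open>X\<close> near \<open>p\<close>, so that one point of \<open>P\<close> is one end; that the
frontier of \<open>W\<close> avoids \<open>P\<close> makes this frontier a compact subset of the
complement and makes \<open>P\<close> zero-dimensional, so that different points of \<open>P\<close>
are different ends. For these two reasons \<open>X\<close> is determined by the complement of
\<open>P\<close>; it is its Freudenthal compactification.\<close>

definition end_compactification :: "'a topology \<Rightarrow> 'a set \<Rightarrow> bool" where
  "end_compactification X P \<longleftrightarrow>
     compact_space X \<and> Hausdorff_space X \<and> closedin X P \<and>
     X closure_of (topspace X - P) = topspace X \<and>
     (\<forall>p\<in>P. \<forall>T. openin X T \<and> p \<in> T \<longrightarrow>
        (\<exists>W. openin X W \<and> p \<in> W \<and> W \<subseteq> T \<and> connectedin X (W - P) \<and> X frontier_of W \<inter> P = {}))"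

lemma end_compactification_neighbourhood:
  assumes "end_compactification X P" "p \<in> P" "openin X T" "p \<in> T"
  obtains W where "openin X W" "p \<in> W" "W \<subseteq> T" "connectedin X (W - P)" "X frontier_of W \<inter> P = {}"
  using assms unfolding end_compactification_def by meson

lemma closedin_image_homeomorphic_maps_complements:
  assumes X: "Hausdorff_space X" and Y: "compact_space Y"
    and hk: "homeomorphic_maps (subtopology X (topspace X - P)) (subtopology Y (topspace Y - Q)) h k"
    and K: "closedin Y K" "K \<inter> Q = {}"
  shows "closedin X (k ` K)" and "k ` K \<subseteq> topspace X - P"
proof -
  have "compactin (subtopology Y (topspace Y - Q)) K"
    using K Y closedin_compact_space closedin_subset[OF K(1)] by (auto simp: compactin_subtopology)
  moreover have "continuous_map (subtopology Y (topspace Y - Q)) (subtopology X (topspace X - P)) k"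
    using hk by (simp add: homeomorphic_maps_def)
  ultimately have "compactin (subtopology X (topspace X - P)) (k ` K)"
    by (rule image_compactin)
  then show "closedin X (k ` K)" "k ` K \<subseteq> topspace X - P"
    using X by (auto simp: compactin_subtopology intro: compactin_imp_closedin)
qed

text \<open>By compactness \<open>h\<close> has some cluster point \<open>l\<close> at
\<open>p\<close>. It lies in \<open>Q\<close>, because \<open>h\<close> is proper: a compact
neighbourhood of a point outside \<open>Q\<close> pulls back to a compact set, which stays away from
\<open>p\<close>. It is the limit, because a small neighbourhood of \<open>l\<close> may be taken
with frontier outside \<open>Q\<close>. This frontier also pulls back to a compact set, so
\<open>h\<close> maps some connected \<open>W - P\<close> near \<open>p\<close> without crossing
it.\<close>

lemma homeomorphism_has_limit_at_end:
  assumes X: "end_compactification X P" and Y: "end_compactification Y Q"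
    and hk: "homeomorphic_maps (subtopology X (topspace X - P)) (subtopology Y (topspace Y - Q)) h k"
    and p: "p \<in> P"
  shows "\<exists>l. limitin Y h l (atin_within X p (topspace X - P))"
proof -
  have cX: "compact_space X" and hX: "Hausdorff_space X" and clP: "closedin X P"
    and dense: "X closure_of (topspace X - P) = topspace X"
    and cY: "compact_space Y" and hY: "Hausdorff_space Y" and clQ: "closedin Y Q"
    using X Y by (auto simp: end_compactification_def)
  have pX: "p \<in> topspace X" using p clP closedin_subset by blast
  have kh: "k (h x) = x" "h x \<in> topspace Y - Q" if "x \<in> topspace X - P" for x
    using hk that by (auto simp: homeomorphic_maps_def continuous_map_def Pi_iff)
  \<comment> \<open>The trace on \<open>Y\<close> of a neighbourhood of \<open>p\<close>; a point in the closure of all traces is a cluster point.\<close>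
  define tr where "tr = (\<lambda>W. h ` (W - P))"
  have trY: "tr W \<subseteq> topspace Y" if "openin X W" for W
    using kh(2) openin_subset[OF that] by (auto simp: tr_def)
  have ne: "W - P \<noteq> {}" if "openin X W" "p \<in> W" for W
  proof -
    have "p \<in> X closure_of (topspace X - P)" using dense pX by simp
    then show ?thesis using that unfolding in_closure_of by auto
  qed
  define \<U> where "\<U> = (\<lambda>W. Y closure_of (tr W)) ` {W. openin X W \<and> p \<in> W}"
  have "\<Inter>\<G> \<noteq> {}" if fin: "finite \<G>" and sub: "\<G> \<subseteq> \<U>" for \<G>
  proof -
    obtain \<W> where W: "finite \<W>" "\<W> \<subseteq> {W. openin X W \<and> p \<in> W}" "\<G> = (\<lambda>W. Y closure_of (tr W)) ` \<W>"
      using finite_subset_image[OF fin sub[unfolded \<U>_def]] by blast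
    have "openin X (\<Inter>(insert (topspace X) \<W>))"
      using W by (intro openin_Inter) auto
    moreover have "p \<in> \<Inter>(insert (topspace X) \<W>)" using W pX by auto
    ultimately have "\<Inter>(insert (topspace X) \<W>) - P \<noteq> {}" by (rule ne)
    then obtain x where x: "x \<in> \<Inter>(insert (topspace X) \<W>)" "x \<notin> P" by blast
    have "h x \<in> Y closure_of (tr W)" if "W \<in> \<W>" for W
    proof -
      have "openin X W" using subsetD[OF W(2) that] by simp
      then have "tr W \<subseteq> Y closure_of (tr W)" by (intro closure_of_subset trY)
      then show ?thesis using x that by (auto simp: tr_def)
    qed
    then have "h x \<in> \<Inter>\<G>" unfolding W(3) by (rule INT_I)
    then show ?thesis by blast
  qed
  moreover have "\<forall>C\<in>\<U>. closedin Y C" by (auto simp: \<U>_def)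
  ultimately have "\<Inter>\<U> \<noteq> {}"
    using cY[unfolded compact_space_fip, rule_format, of \<U>] by simp
  then obtain l where l: "\<And>W. openin X W \<Longrightarrow> p \<in> W \<Longrightarrow> l \<in> Y closure_of (tr W)"
    by (auto simp: \<U>_def)
  have lY: "l \<in> topspace Y" using l[of "topspace X"] pX by (auto simp: in_closure_of)
  have meets: "\<exists>x \<in> W - P. h x \<in> T" if "openin X W" "p \<in> W" "openin Y T" "l \<in> T" for W T
    using l[OF that(1,2)] that(3,4) by (auto simp: in_closure_of tr_def)
  have lQ: "l \<in> Q"
  proof (rule ccontr)
    assume "l \<notin> Q"
    have "regular_space Y" using cY hY compact_Hausdorff_imp_regular_space by blast
    then obtain T N where TN: "openin Y T" "closedin Y N" "l \<in> T" "T \<subseteq> N" "N \<subseteq> topspace Y - Q"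
      using \<open>l \<notin> Q\<close> lY clQ unfolding neighbourhood_base_of_closedin[symmetric] neighbourhood_base_of
      by (metis Diff_iff openin_diff openin_topspace)
    have N: "closedin X (k ` N)" "k ` N \<subseteq> topspace X - P"
      using closedin_image_homeomorphic_maps_complements[OF hX cY hk TN(2)] TN(5) by auto
    then have "openin X (topspace X - k ` N)" "p \<in> topspace X - k ` N"
      using p pX by auto
    then obtain x where "x \<in> topspace X - k ` N - P" "h x \<in> T"
      using meets TN(1,3) by blast
    then show False using TN(4) kh(1) by (metis Diff_iff image_eqI subsetD)
  qed
  have "limitin Y h l (atin_within X p (topspace X - P))"
    unfolding limitin_def
  proof (intro conjI allI impI lY)
    fix T assume T: "openin Y T \<and> l \<in> T"
    then obtain W' where W': "openin Y W'" "l \<in> W'" "W' \<subseteq> T" "Y frontier_of W' \<inter> Q = {}"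
      using end_compactification_neighbourhood[OF Y lQ] by metis
    let ?K = "k ` (Y frontier_of W')"
    have K: "closedin X ?K" "?K \<subseteq> topspace X - P"
      using closedin_image_homeomorphic_maps_complements[OF hX cY hk closedin_frontier_of W'(4)] by auto
    then have "openin X (topspace X - ?K)" "p \<in> topspace X - ?K"
      using p pX by auto
    then obtain W where W: "openin X W" "p \<in> W" "W \<subseteq> topspace X - ?K" "connectedin X (W - P)"
      using end_compactification_neighbourhood[OF X p] by metis
    have "connectedin (subtopology X (topspace X - P)) (W - P)"
      using W(4) openin_subset[OF W(1)] by (auto simp: connectedin_subtopology)
    moreover have "continuous_map (subtopology X (topspace X - P)) (subtopology Y (topspace Y - Q)) h"
      using hk by (simp add: homeomorphic_maps_def)
    ultimately have "connectedin (subtopology Y (topspace Y - Q)) (h ` (W - P))"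
      using connectedin_continuous_map_image by blast
    then have con: "connectedin Y (h ` (W - P))" by (simp add: connectedin_subtopology)
    have mt: "h ` (W - P) \<inter> W' \<noteq> {}" using meets[OF W(1,2) W'(1,2)] by blast
    have "h ` (W - P) \<inter> Y frontier_of W' = {}"
    proof -
      have False if "x \<in> W - P" "h x \<in> Y frontier_of W'" for x
        using that W(3) kh(1)[of x] by (metis Diff_iff image_eqI subsetD)
      then show ?thesis by blast
    qed
    then have "h ` (W - P) - W' = {}"
      using connectedin_Int_frontier_of[OF con mt] by blast
    then have "h ` (W - P) \<subseteq> T" using W'(3) by blast
    then show "\<forall>\<^sub>F x in atin_within X p (topspace X - P). h x \<in> T"
      unfolding eventually_atin_within using W(1,2) by (intro disjI2) blast
  qed
  then show ?thesis by blast
qed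

lemma homeomorphism_extends_to_ends:
  assumes X: "end_compactification X P" and Y: "end_compactification Y Q"
    and hk: "homeomorphic_maps (subtopology X (topspace X - P)) (subtopology Y (topspace Y - Q)) h k"
  obtains g where "continuous_map X Y g" "\<And>x. x \<in> topspace X - P \<Longrightarrow> g x = h x"
proof -
  have reg: "regular_space Y"
    using Y by (simp add: end_compactification_def compact_Hausdorff_imp_regular_space)
  have clP: "closedin X P" using X by (simp add: end_compactification_def)
  have dense: "topspace X \<subseteq> X closure_of (topspace X - P)" using X by (simp add: end_compactification_def)
  have "continuous_map (subtopology X (topspace X - P)) Y h"
    using hk by (auto simp: homeomorphic_maps_def continuous_map_in_subtopology)
  then obtain g where "continuous_map (subtopology X (topspace X)) Y g"
       "\<And>x. x \<in> topspace X - P \<Longrightarrow> g x = h x"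
    using continuous_map_extension_pointwise_alt[OF reg Diff_subset dense]
      homeomorphism_has_limit_at_end[OF X Y hk] by (metis Diff_iff)
  then show ?thesis using that by simp
qed

text \<open>The extensions of a homeomorphism and of its inverse are inverse to each other, since
they are on a dense set. Neither can move a point of the boundary into the complement, since the
other one would have to bring it back.\<close>

lemma homeomorphic_complements_imp_homeomorphic_ends:
  assumes X: "end_compactification X P" and Y: "end_compactification Y Q"
    and hom: "subtopology X (topspace X - P) homeomorphic_space subtopology Y (topspace Y - Q)"
  shows "subtopology X P homeomorphic_space subtopology Y Q"
proof -
  obtain h k where hk: "homeomorphic_maps (subtopology X (topspace X - P)) (subtopology Y (topspace Y - Q)) h k"
    using hom by (auto simp: homeomorphic_space_def)
  then have kh: "homeomorphic_maps (subtopology Y (topspace Y - Q)) (subtopology X (topspace X - P)) k h"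
    by (simp only: homeomorphic_maps_sym[of "subtopology Y (topspace Y - Q)"])
  obtain f where f: "continuous_map X Y f" "\<And>x. x \<in> topspace X - P \<Longrightarrow> f x = h x"
    using homeomorphism_extends_to_ends[OF X Y hk] by blast
  obtain g where g: "continuous_map Y X g" "\<And>x. x \<in> topspace Y - Q \<Longrightarrow> g x = k x"
    using homeomorphism_extends_to_ends[OF Y X kh] by blast
  have h: "h x \<in> topspace Y - Q" "k (h x) = x" if "x \<in> topspace X - P" for x
    using hk that by (auto simp: homeomorphic_maps_def continuous_map_def Pi_iff)
  have k: "k y \<in> topspace X - P" "h (k y) = y" if "y \<in> topspace Y - Q" for y
    using hk that by (auto simp: homeomorphic_maps_def continuous_map_def Pi_iff)
  have clP: "P \<subseteq> topspace X" and clQ: "Q \<subseteq> topspace Y"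
    using X Y by (auto simp: end_compactification_def closedin_def)
  have gf: "g (f x) = x" if "x \<in> topspace X" for x
  proof -
    have "(g \<circ> f) x = id x"
    proof (rule forall_in_closure_of_eq[where X=X and Y=X and S = "topspace X - P" and f = "g \<circ> f" and g = id and x = x])
      show "continuous_map X X (g \<circ> f)" using f g continuous_map_compose by blast
    qed (use X that f(2) g(2) h in \<open>auto simp: end_compactification_def\<close>)
    then show ?thesis by simp
  qed
  have fg: "f (g y) = y" if "y \<in> topspace Y" for y
  proof -
    have "(f \<circ> g) y = id y"
    proof (rule forall_in_closure_of_eq[where X=Y and Y=Y and S = "topspace Y - Q" and f = "f \<circ> g" and g = id and x = y])
      show "continuous_map Y Y (f \<circ> g)" using f g continuous_map_compose by blast
    qed (use Y that f(2) g(2) k in \<open>auto simp: end_compactification_def\<close>)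
    then show ?thesis by simp
  qed
  have fP: "f x \<in> Q" if "x \<in> P" for x
  proof (rule ccontr)
    assume "f x \<notin> Q"
    then have "f x \<in> topspace Y - Q" using f(1) that clP by (auto simp: continuous_map_def)
    then have "g (f x) \<in> topspace X - P" using g(2) k(1) by simp
    then show False using gf that clP by auto
  qed
  have gQ: "g y \<in> P" if "y \<in> Q" for y
  proof (rule ccontr)
    assume "g y \<notin> P"
    then have "g y \<in> topspace X - P" using g(1) that clQ by (auto simp: continuous_map_def)
    then have "f (g y) \<in> topspace Y - Q" using f(2) h(1) by simp
    then show False using fg that clQ by auto
  qed
  have "homeomorphic_maps (subtopology X P) (subtopology Y Q) f g"
    unfolding homeomorphic_maps_def
    using f(1) g(1) gf fg fP gQ clP clQ
    by (auto simp: continuous_map_in_subtopology continuous_map_from_subtopology)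
  then show ?thesis by (auto simp: homeomorphic_space_def)
qed

section \<open>Complements of compact sets on a line\<close>

definition no_interval :: "real set \<Rightarrow> bool" where
  "no_interval D \<longleftrightarrow> (\<forall>u v. u < v \<longrightarrow> (\<exists>t. u < t \<and> t < v \<and> t \<notin> D))"

text \<open>The line lies in the hyperplane orthogonal to \<open>b\<close>. Any point
\<open>z\<close> of \<open>W\<close> in this hyperplane that is not removed joins the two open
halves of \<open>W\<close>, as each half together with \<open>z\<close> is convex. Such a
\<open>z\<close> exists as soon as the hyperplane meets \<open>W\<close>, because \<open>D\<close>
contains no interval.\<close>

lemma connected_convex_minus_line_set:
  fixes e b :: "'e::euclidean_space"
  assumes eb: "e \<in> Basis" "b \<in> Basis" "e \<noteq> b"
    and D: "no_interval D" and W: "open W" "convex W"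
  shows "connected (W - (\<lambda>t. t *\<^sub>R e) ` D)" (is "connected (W - ?C)")
proof -
  have ebi: "e \<bullet> b = 0" "b \<bullet> b = 1" "e \<bullet> e = 1"
    using eb by (simp_all add: inner_Basis)
  define Z where "Z = {x\<in>W. x \<bullet> b = 0} - ?C"
  define A where "A = (\<lambda>z. insert z {x\<in>W. x \<bullet> b > 0})"
  define B where "B = (\<lambda>z. insert z {x\<in>W. x \<bullet> b < 0})"
  have step: "\<exists>s>0. x + s *\<^sub>R b \<in> W" if x: "x \<in> W" for x
  proof -
    obtain \<epsilon> where \<epsilon>: "\<epsilon> > 0" "ball x \<epsilon> \<subseteq> W"
      using openE[OF W(1) x] by blast
    then have "x + (\<epsilon> / 2) *\<^sub>R b \<in> W" using eb(2) by (intro subsetD[OF \<epsilon>(2)]) (auto simp: dist_norm)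
    then show ?thesis using \<epsilon>(1) by (intro exI[of _ "\<epsilon> / 2"]) auto
  qed
  have Zne: "Z \<noteq> {}" if x: "x \<in> W" "x \<bullet> b = 0" for x
  proof -
    obtain \<epsilon> where \<epsilon>: "\<epsilon> > 0" "ball x \<epsilon> \<subseteq> W"
      using openE[OF W(1) x(1)] by blast
    obtain t where t: "x \<bullet> e < t" "t < x \<bullet> e + \<epsilon>" "t \<notin> D"
      using D \<epsilon>(1) unfolding no_interval_def by (metis less_add_same_cancel1)
    let ?y = "x + (t - x \<bullet> e) *\<^sub>R e"
    have "?y \<in> W" using \<epsilon> t eb by (intro subsetD[OF \<epsilon>(2)]) (auto simp: dist_norm)
    moreover have "?y \<bullet> b = 0" using x(2) ebi by (simp add: inner_add_left)
    moreover have "?y \<bullet> e = t" using ebi by (simp add: inner_add_left)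
    then have "?y \<notin> ?C" using t(3) ebi by auto
    ultimately show ?thesis unfolding Z_def by blast
  qed
  have cvxA: "convex (A z)" and cvxB: "convex (B z)" if "z \<in> Z" for z
  proof -
    have z: "z \<in> W" "z \<bullet> b = 0" using that by (auto simp: Z_def)
    have pos: "0 < u * p + v * q" if "0 \<le> u" "0 \<le> v" "u + v = 1" "0 < p" "0 < q" for u v p q :: real
      using that by (cases "u = 0") (auto intro: add_pos_nonneg)
    have zz: "u *\<^sub>R z + v *\<^sub>R z = z" if "u + v = 1" for u v
      using that by (metis scaleR_add_left scaleR_one)
    have W': "u *\<^sub>R x + v *\<^sub>R y \<in> W" if "x \<in> W" "y \<in> W" "0 \<le> u" "0 \<le> v" "u + v = 1" for x y u v
      using W(2) that by (auto simp: convex_def)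
    show "convex (A z)"
      unfolding convex_def
    proof (intro ballI allI impI)
      fix x y :: 'e and u v :: real
      assume h: "x \<in> A z" "y \<in> A z" "0 \<le> u" "0 \<le> v" "u + v = 1"
      show "u *\<^sub>R x + v *\<^sub>R y \<in> A z"
        using h z zz[OF h(5)] W'[of x y u v] pos[OF h(3-5), of "x \<bullet> b" "y \<bullet> b"]
        by (cases "u = 0"; cases "v = 0") (auto simp: A_def inner_add_left)
    qed
    have neg: "u * p + v * q < 0" if "0 \<le> u" "0 \<le> v" "u + v = 1" "p < 0" "q < 0" for u v p q :: real
      using pos[of u v "-p" "-q"] that by simp
    show "convex (B z)"
      unfolding convex_def
    proof (intro ballI allI impI)
      fix x y :: 'e and u v :: real
      assume h: "x \<in> B z" "y \<in> B z" "0 \<le> u" "0 \<le> v" "u + v = 1"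
      show "u *\<^sub>R x + v *\<^sub>R y \<in> B z"
        using h z zz[OF h(5)] W'[of x y u v] neg[OF h(3-5), of "x \<bullet> b" "y \<bullet> b"]
        by (cases "u = 0"; cases "v = 0") (auto simp: B_def inner_add_left mult_neg_pos mult_pos_neg)
    qed
  qed
  have Csub: "x \<bullet> b = 0" if "x \<in> ?C" for x using that ebi by auto
  show ?thesis
  proof (cases "Z = {}")
    case True
    then have "W - ?C = W" using Zne Csub by blast
    then show ?thesis using W(2) convex_connected by simp
  next
    case False
    then obtain z0 where z0: "z0 \<in> Z" by blast
    then obtain s where s: "0 < s" "z0 + s *\<^sub>R b \<in> W" using step[of z0] by (auto simp: Z_def)
    have "z0 + s *\<^sub>R b \<in> A z" for z
      using s z0 ebi by (auto simp: A_def Z_def inner_add_left)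
    then have ne: "\<Inter> ((\<lambda>z. A z \<union> B z) ` Z) \<noteq> {}" by blast
    have "connected (A z \<union> B z)" if "z \<in> Z" for z
    proof (rule connected_Un)
      show "connected (A z)" "connected (B z)" using cvxA cvxB that convex_connected by auto
      show "A z \<inter> B z \<noteq> {}" by (auto simp: A_def B_def)
    qed
    then have "connected (\<Union> ((\<lambda>z. A z \<union> B z) ` Z))"
      using ne by (intro connected_Union) auto
    moreover have "W - ?C = \<Union> ((\<lambda>z. A z \<union> B z) ` Z)" (is "?L = ?R")
    proof
      show "?L \<subseteq> ?R"
      proof
        fix x assume x: "x \<in> ?L"
        show "x \<in> ?R"
        proof (cases "x \<bullet> b = 0")
          case True
          then show ?thesis using x by (auto simp: Z_def A_def)
        next
          case False
          then have "x \<in> A z0 \<union> B z0" using x by (auto simp: A_def B_def)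
          then show ?thesis using z0 by blast
        qed
      qed
      show "?R \<subseteq> ?L" using ebi by (auto simp: Z_def A_def B_def)
    qed
    ultimately show ?thesis by simp
  qed
qed

lemma not_in_closure_of:
  assumes "openin X T" "x \<in> T" "T \<inter> S = {}"
  shows "x \<notin> X closure_of S"
  using assms by (metis disjoint_iff in_closure_of)

lemma Alexandroff_closure_of_Some:
  fixes W :: "'e::euclidean_space set"
  assumes "Some x \<in> Alexandroff_compactification euclidean closure_of (Some ` W)"
  shows "x \<in> closure W"
proof (rule ccontr)
  assume "x \<notin> closure W"
  then have "openin (Alexandroff_compactification euclidean) (Some ` (- closure W))" "Some x \<in> Some ` (- closure W)"
    by auto
  moreover have "Some ` (- closure W) \<inter> Some ` W = {}" using closure_subset by auto
  ultimately show False using assms not_in_closure_of by metis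
qed

lemma Alexandroff_None_neighbourhood:
  fixes T :: "'e::euclidean_space option set"
  assumes "openin (Alexandroff_compactification euclidean) T" "None \<in> T"
  obtains K where "compact K" "T = insert None (Some ` (- K))"
  using assms unfolding openin_Alexandroff_compactification by (auto simp: Compl_eq_Diff_UNIV)

lemma Alexandroff_openin_None:
  fixes K :: "'e::euclidean_space set"
  assumes "compact K"
  shows "openin (Alexandroff_compactification euclidean) (insert None (Some ` (- K)))"
  using assms unfolding openin_Alexandroff_compactification
  by (auto simp: Compl_eq_Diff_UNIV compact_imp_closed)

lemma Alexandroff_open_vimage:
  fixes T :: "'e::euclidean_space option set"
  assumes "openin (Alexandroff_compactification euclidean) T"
  shows "open {x. Some x \<in> T}"
  using openin_continuous_map_preimage[OF continuous_map_Some assms] by simp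

lemma open_not_subset_line:
  fixes e b :: "'e::euclidean_space"
  assumes eb: "e \<in> Basis" "b \<in> Basis" "e \<noteq> b" and T: "open T" "T \<noteq> {}"
  shows "\<not> T \<subseteq> (\<lambda>t. t *\<^sub>R e) ` D"
proof
  assume sub: "T \<subseteq> (\<lambda>t. t *\<^sub>R e) ` D"
  have i: "e \<bullet> b = 0" using eb by (simp add: inner_Basis)
  obtain x \<epsilon> where \<epsilon>: "\<epsilon> > 0" "ball x \<epsilon> \<subseteq> T" using T openE by (metis ex_in_conv)
  have "x + (\<epsilon>/2) *\<^sub>R b \<in> T" "x \<in> T"
    using \<epsilon> eb by (auto intro!: subsetD[OF \<epsilon>(2)] simp: dist_norm)
  then have "x \<bullet> b = 0" "(x + (\<epsilon>/2) *\<^sub>R b) \<bullet> b = 0" using sub i by auto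
  then show False using eb \<epsilon>(1) by (simp add: inner_add_left)
qed

text \<open>A point of the line has as neighbourhoods the balls around it, cut down to a slab whose
two faces cross the line outside \<open>D\<close>; these are convex. The point at infinity has the
complements of large balls, which are connected in dimension at least two.\<close>

lemma end_compactification_line_set:
  fixes e b :: "'e::euclidean_space"
  assumes eb: "e \<in> Basis" "b \<in> Basis" "e \<noteq> b"
    and D: "no_interval D" "compact D"
  shows "end_compactification (Alexandroff_compactification euclidean)
           (insert None (Some ` ((\<lambda>t. t *\<^sub>R e) ` D)))"
    (is "end_compactification ?X (insert None (Some ` ?C))")
proof -
  let ?P = "insert None (Some ` ?C)"
  have ei: "e \<bullet> e = 1" "norm e = 1" using eb by auto
  have C: "compact ?C" using D(2) by (intro compact_continuous_image continuous_intros)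
  have lc: "locally_compact_space (euclidean :: 'e topology)"
    using locally_compact_UNIV locally_compact_space_euclidean by blast
  have compl: "topspace ?X - ?P = Some ` (- ?C)"
    by auto
  have 1: "Hausdorff_space ?X"
    using lc by (simp add: Hausdorff_space_Alexandroff_compactification)
  have 2: "closedin ?X ?P"
    unfolding closedin_def compl
    using C by (auto simp: compact_imp_closed open_Compl)
  have 3: "?X closure_of (topspace ?X - ?P) = topspace ?X"
  proof (rule antisym[OF closure_of_subset_topspace], rule subsetI)
    fix x assume x: "x \<in> topspace ?X"
    have "\<exists>y\<in>Some ` (- ?C). y \<in> T" if T: "openin ?X T" "x \<in> T" for T
    proof (cases x)
      case None
      then obtain K where K: "compact K" "T = insert None (Some ` (- K))"
        using Alexandroff_None_neighbourhood T by metis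
      have "?C \<union> K \<noteq> UNIV" using compact_Un[OF C K(1)] not_compact_UNIV by metis
      then show ?thesis using K(2) by auto
    next
      case (Some z)
      have "\<not> {x. Some x \<in> T} \<subseteq> ?C"
        using open_not_subset_line[OF eb Alexandroff_open_vimage[OF T(1)]] T(2) Some by blast
      then show ?thesis by auto
    qed
    then show "x \<in> ?X closure_of (topspace ?X - ?P)"
      unfolding compl in_closure_of using x by blast
  qed
  \<comment> \<open>The point at infinity comes first, then the points of the line.\<close>
  have 4: "\<exists>W. openin ?X W \<and> p \<in> W \<and> W \<subseteq> T \<and> connectedin ?X (W - ?P) \<and> ?X frontier_of W \<inter> ?P = {}"
    if p: "p \<in> ?P" and T: "openin ?X T" "p \<in> T" for p T
  proof (cases p)
    case None
    then obtain K where K: "compact K" "T = insert None (Some ` (- K))"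
      using Alexandroff_None_neighbourhood T by metis
    have "bounded (?C \<union> K)" using compact_Un[OF C K(1)] compact_imp_bounded by blast
    then obtain r where r: "?C \<union> K \<subseteq> ball 0 r" using bounded_subset_ballD by blast
    let ?W = "insert None (Some ` (- cball (0::'e) r))"
    have op: "openin ?X ?W" by (rule Alexandroff_openin_None) simp
    have "2 \<le> DIM('e)"
      using card_mono[OF finite_Basis, of "{e, b}"] eb by auto
    then have "connected (- cball (0::'e) r)"
      by (intro connected_complement_bounded_convex) auto
    then have "connectedin ?X (Some ` (- cball (0::'e) r))"
      by (intro connectedin_continuous_map_image[OF continuous_map_Some]) simp
    moreover have "?W - ?P = Some ` (- cball (0::'e) r)" using r by (auto simp: subset_iff)
    moreover have "?X frontier_of ?W \<inter> ?P = {}"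
    proof -
      have "Some c \<notin> ?X closure_of ?W" if "c \<in> ?C" for c
      proof -
        have "openin ?X (Some ` ball 0 r)" "Some c \<in> Some ` ball 0 r" using that r by auto
        moreover have "Some ` ball 0 r \<inter> ?W = {}" by auto
        ultimately show ?thesis by (rule not_in_closure_of)
      qed
      then show ?thesis
        using op by (auto simp: frontier_of_def interior_of_openin)
    qed
    moreover have "?W \<subseteq> T" using r K(2) by (auto simp: subset_iff)
    ultimately show ?thesis using op None by (intro exI[of _ ?W]) auto
  next
    case (Some c)
    then obtain t0 where t0: "t0 \<in> D" "c = t0 *\<^sub>R e" using p by auto
    have "open {x. Some x \<in> T}" "c \<in> {x. Some x \<in> T}"
      using Alexandroff_open_vimage[OF T(1)] T(2) Some by auto
    then obtain \<delta> where \<delta>: "\<delta> > 0" "cball c \<delta> \<subseteq> {x. Some x \<in> T}"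
      using open_contains_cball by metis
    obtain u where u: "t0 - \<delta> < u" "u < t0" "u \<notin> D"
      using D(1) \<delta>(1) unfolding no_interval_def by (metis diff_less_eq less_add_same_cancel1)
    obtain v where v: "t0 < v" "v < t0 + \<delta>" "v \<notin> D"
      using D(1) \<delta>(1) unfolding no_interval_def by (metis less_add_same_cancel1)
    define W where "W = {x. u < e \<bullet> x} \<inter> {x. e \<bullet> x < v} \<inter> ball c \<delta>"
    have oW: "open W" unfolding W_def
      by (intro open_Int open_halfspace_gt open_halfspace_lt open_ball)
    have cW: "convex W" unfolding W_def
      by (intro convex_Int convex_halfspace_gt convex_halfspace_lt convex_ball)
    have clW: "closure W \<subseteq> {x. u \<le> e \<bullet> x} \<inter> {x. e \<bullet> x \<le> v} \<inter> cball c \<delta>"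
      by (intro closure_minimal closed_Int closed_halfspace_ge closed_halfspace_le closed_cball)
         (auto simp: W_def)
    have op: "openin ?X (Some ` W)" using oW by simp
    have "connectedin ?X (Some ` (W - ?C))"
      using connected_convex_minus_line_set[OF eb D(1) oW cW]
      by (intro connectedin_continuous_map_image[OF continuous_map_Some]) simp
    moreover have "Some ` W - ?P = Some ` (W - ?C)" by auto
    moreover have "c \<in> W" using t0 u v \<delta>(1) ei by (auto simp: W_def)
    moreover have "Some ` W \<subseteq> T" using \<delta>(2) by (auto simp: W_def subset_iff)
    moreover have "?X frontier_of (Some ` W) \<inter> ?P = {}"
    proof -
      have "q \<in> Some ` W" if q: "q \<in> ?P" "q \<in> ?X closure_of (Some ` W)" for q
      proof (cases q)
        case None
        have "openin ?X (insert None (Some ` (- cball c \<delta>)))" by (rule Alexandroff_openin_None) simp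
        moreover have "None \<in> insert None (Some ` (- cball c \<delta>))" by simp
        moreover have "insert None (Some ` (- cball c \<delta>)) \<inter> Some ` W = {}" by (auto simp: W_def)
        ultimately have "None \<notin> ?X closure_of (Some ` W)" by (rule not_in_closure_of)
        then show ?thesis using q(2) None by simp
      next
        case (Some x)
        then obtain t where t: "t \<in> D" "x = t *\<^sub>R e" using q(1) by auto
        have "x \<in> closure W" using q(2) Some Alexandroff_closure_of_Some by blast
        then have "u \<le> t" "t \<le> v" using clW t(2) ei by auto
        then have uv: "u < t" "t < v" using t(1) u(3) v(3) by (auto simp: order.order_iff_strict)
        then have "\<bar>t0 - t\<bar> < \<delta>" using u v by auto
        moreover have "dist c x = \<bar>t0 - t\<bar>"
          using t(2) t0(2) ei by (simp add: dist_norm flip: scaleR_diff_left)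
        ultimately have "x \<in> W" using uv t(2) ei by (auto simp: W_def)
        then show ?thesis using Some by blast
      qed
      then show ?thesis using op by (auto simp: frontier_of_def interior_of_openin)
    qed
    ultimately show ?thesis using op Some by (intro exI[of _ "Some ` W"]) auto
  qed
  show ?thesis
    unfolding end_compactification_def using 1 2 3 4 by (intro conjI ballI allI impI) auto
qed

section \<open>Compact spaces with prescribed Cantor-Bendixson spectrum\<close>

primrec CB_derivative :: "'a topology \<Rightarrow> nat \<Rightarrow> 'a set" where
  "CB_derivative X 0 = topspace X"
| "CB_derivative X (Suc n) = X derived_set_of CB_derivative X n"

text \<open>The points of Cantor-Bendixson rank exactly \<open>n\<close>.\<close>

definition CB_level :: "'a topology \<Rightarrow> nat \<Rightarrow> 'a set" where
  "CB_level X n = CB_derivative X n - CB_derivative X (Suc n)"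

text \<open>The numbers \<open>n\<close> for which some point is a limit of points of rank
\<open>n\<close>, but neither has rank \<open>n + 1\<close> nor is a limit of such points. In a
scattered space there are no such numbers, because a point of higher rank than \<open>n + 1\<close>
is also a limit of points of rank \<open>n + 1\<close>; what the spectrum sees are points of the
perfect kernel at which scattered points of bounded rank accumulate.\<close>

definition CB_spectrum :: "'a topology \<Rightarrow> nat set" where
  "CB_spectrum X = {n. \<not> X derived_set_of CB_level X n \<subseteq> X closure_of CB_level X (Suc n)}"

lemma CB_derivative_subset: "CB_derivative X n \<subseteq> topspace X"
  by (cases n) (auto simp: derived_set_of_subset_topspace)

lemma CB_spectrum_homeomorphic:
  assumes "X homeomorphic_space Y"
  shows "CB_spectrum X = CB_spectrum Y"
proof -
  obtain f where f: "homeomorphic_map X Y f"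
    using assms homeomorphic_space by blast
  have inj: "inj_on f (topspace X)" using f by (simp add: homeomorphic_eq_everything_map)
  have D: "CB_derivative Y n = f ` CB_derivative X n" for n
  proof (induction n)
    case 0
    then show ?case using f by (simp add: homeomorphic_eq_everything_map)
  next
    case (Suc n)
    then show ?case using homeomorphic_map_derived_set_of[OF f CB_derivative_subset] by simp
  qed
  have L: "CB_level Y n = f ` CB_level X n" for n
    unfolding CB_level_def D
    using inj_on_image_set_diff[OF inj _ CB_derivative_subset] CB_derivative_subset by (metis Diff_subset subset_trans)
  have sub: "CB_level X n \<subseteq> topspace X" for n
    using CB_derivative_subset[of X n] by (auto simp: CB_level_def)
  show ?thesis
    unfolding CB_spectrum_def L homeomorphic_map_derived_set_of[OF f sub] homeomorphic_map_closure_of[OF f sub]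
    using inj_on_image_subset_iff[OF inj derived_set_of_subset_topspace closure_of_subset_topspace]
    by auto
qed

text \<open>The cylinders around a point form a neighbourhood base, which turns limit points and
closures into statements about agreement on initial segments.\<close>

definition cylinder :: "nat \<Rightarrow> (nat \<Rightarrow> bool) \<times> (nat \<Rightarrow> bool) \<Rightarrow> ((nat \<Rightarrow> bool) \<times> (nat \<Rightarrow> bool)) set" where
  "cylinder k z = {w. \<forall>i<k. fst w i = fst z i \<and> snd w i = snd z i}"

lemma open_coordinates_agree: "open {f :: nat \<Rightarrow> bool. \<forall>i<k. f i = g i}"
proof -
  have "{f :: nat \<Rightarrow> bool. \<forall>i<k. f i = g i} = (\<Inter>i\<in>{..<k}. (\<lambda>f. f i) -` {g i})" by auto
  moreover have "open ((\<lambda>f :: nat \<Rightarrow> bool. f i) -` {g i})" for i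
    by (intro open_vimage open_discrete continuous_on_product_coordinates)
  ultimately show ?thesis by (simp add: open_INT)
qed

lemma open_contains_coordinates_agree:
  assumes "open U" "g \<in> U"
  shows "\<exists>k. {f :: nat \<Rightarrow> bool. \<forall>i<k. f i = g i} \<subseteq> U"
proof -
  have "openin (product_topology (\<lambda>_. euclidean) UNIV) U"
    using assms(1) by (simp add: open_fun_def)
  from product_topology_open_contains_basis[OF this assms(2)]
  obtain X where X: "g \<in> (\<Pi>\<^sub>E i\<in>UNIV. X i)" "finite {i. X i \<noteq> topspace euclidean}" "(\<Pi>\<^sub>E i\<in>UNIV. X i) \<subseteq> U"
    by blast
  obtain k where k: "{i. X i \<noteq> topspace euclidean} \<subseteq> {..<k}"
    using X(2) finite_nat_bounded by blast
  have "f \<in> (\<Pi>\<^sub>E i\<in>UNIV. X i)" if "\<forall>i<k. f i = g i" for f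
  proof (simp add: PiE_def Pi_iff, intro allI)
    fix i show "f i \<in> X i"
      using X(1) k that by (cases "i < k") (auto simp: PiE_def Pi_iff)
  qed
  then have "{f. \<forall>i<k. f i = g i} \<subseteq> U"
    by (intro subsetI subsetD[OF X(3)]) simp
  then show ?thesis by (rule exI)
qed

lemma open_cylinder: "open (cylinder k z)"
proof -
  have "cylinder k z = {f. \<forall>i<k. f i = fst z i} \<times> {f. \<forall>i<k. f i = snd z i}"
    by (auto simp: cylinder_def)
  then show ?thesis by (simp add: open_Times open_coordinates_agree)
qed

lemma open_contains_cylinder:
  assumes "open U" "z \<in> U"
  obtains k where "cylinder k z \<subseteq> U"
proof -
  obtain A B where AB: "open A" "open B" "z \<in> A \<times> B" "A \<times> B \<subseteq> U"
    using assms open_prod_elim by metis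
  have "fst z \<in> A" "snd z \<in> B" using AB(3) by auto
  from open_contains_coordinates_agree[OF AB(1) this(1)] open_contains_coordinates_agree[OF AB(2) this(2)]
  obtain k l where k: "{f. \<forall>i<k. f i = fst z i} \<subseteq> A" and l: "{f. \<forall>i<l. f i = snd z i} \<subseteq> B"
    by (elim exE)
  have "w \<in> A \<times> B" if "w \<in> cylinder (max k l) z" for w
    using that k l unfolding mem_Times_iff by (intro conjI subsetD[OF k] subsetD[OF l]) (auto simp: cylinder_def)
  then show ?thesis using that[of "max k l"] AB(4) by blast
qed

lemma self_in_cylinder: "z \<in> cylinder k z"
  by (simp add: cylinder_def)

lemma islimpt_iff_cylinder: "z islimpt A \<longleftrightarrow> (\<forall>k. \<exists>w\<in>A. w \<noteq> z \<and> w \<in> cylinder k z)"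
proof (intro iffI allI islimptI)
  fix k assume "z islimpt A"
  then show "\<exists>w\<in>A. w \<noteq> z \<and> w \<in> cylinder k z"
    using islimptE[OF _ self_in_cylinder open_cylinder] by metis
next
  fix U assume h: "\<forall>k. \<exists>w\<in>A. w \<noteq> z \<and> w \<in> cylinder k z" and U: "z \<in> U" "open U"
  obtain k where "cylinder k z \<subseteq> U" by (rule open_contains_cylinder[OF U(2,1)])
  then show "\<exists>y\<in>A. y \<in> U \<and> y \<noteq> z" using h by (metis subsetD)
qed

lemma closure_iff_cylinder: "z \<in> closure A \<longleftrightarrow> (\<forall>k. \<exists>w\<in>A. w \<in> cylinder k z)"
proof (intro iffI allI)
  fix k assume "z \<in> closure A"
  then have "cylinder k z \<inter> closure A \<noteq> {}" using self_in_cylinder[of z k] by auto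
  then have "cylinder k z \<inter> A \<noteq> {}" using open_Int_closure_eq_empty[OF open_cylinder] by metis
  then show "\<exists>w\<in>A. w \<in> cylinder k z" by auto
next
  assume h: "\<forall>k. \<exists>w\<in>A. w \<in> cylinder k z"
  show "z \<in> closure A"
  proof (cases "z \<in> A")
    case False
    then have "z islimpt A" unfolding islimpt_iff_cylinder using h by metis
    then show ?thesis by (simp add: closure_def)
  qed (use closure_subset in auto)
qed

text \<open>Binary sequences are read as sets of natural numbers. The set with index 0 is a closed
set of pairs with Cantor-Bendixson spectrum \<open>S\<close>, and the others are its iterated
derived sets. The pairs \<open>(B, F)\<close> with \<open>F\<close> empty form the perfect kernel.
For each \<open>m\<close> in \<open>S\<close> the kernel point \<open>({m}, {})\<close> is the limit
of a scattered cluster: the pairs \<open>({m}, F)\<close> with \<open>F\<close> finite and nonempty,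
at most \<open>m + 1\<close> elements, all beyond \<open>m\<close>. Such a pair is the limit of
those with one more element in \<open>F\<close>, hence its rank is \<open>m + 1 - card F\<close>,
and the cluster contains all ranks up to \<open>m\<close>. Requiring the elements of
\<open>F\<close> to exceed \<open>m\<close> lets the clusters shrink towards the kernel as
\<open>m\<close> grows, so that the union over \<open>S\<close> is closed.\<close>

definition ranked :: "nat set \<Rightarrow> nat \<Rightarrow> ((nat \<Rightarrow> bool) \<times> (nat \<Rightarrow> bool)) set" where
  "ranked S n = {(B, F). {i. F i} = {} \<or>
      (\<exists>m\<in>S. B = (\<lambda>i. i = m) \<and> finite {i. F i} \<and> {i. F i} \<subseteq> {m<..} \<and> card {i. F i} + n \<le> m + 1)}"

definition exact_rank :: "nat set \<Rightarrow> nat \<Rightarrow> ((nat \<Rightarrow> bool) \<times> (nat \<Rightarrow> bool)) set" where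
  "exact_rank S n = {(B, F). {i. F i} \<noteq> {} \<and>
      (\<exists>m\<in>S. B = (\<lambda>i. i = m) \<and> finite {i. F i} \<and> {i. F i} \<subseteq> {m<..} \<and> card {i. F i} + n = m + 1)}"

lemma exact_rank_eq: "exact_rank S n = ranked S n - ranked S (Suc n)"
proof -
  have "(\<lambda>i. i = m) = (\<lambda>i::nat. i = m') \<longleftrightarrow> m = m'" for m m' by metis
  then show ?thesis
    unfolding exact_rank_def ranked_def by fastforce
qed

lemma add_far_elements:
  assumes "finite {i. F i}" "{i. F i} \<subseteq> {m<..}" "card {i. F i} \<le> c"
  shows "\<exists>G. finite {i::nat. G i} \<and> {i. G i} \<subseteq> {m<..} \<and> card {i. G i} = c \<and> (\<forall>i<k. G i = F i)"
proof -
  obtain N where N: "{i. F i} \<subseteq> {..<N}" using finite_nat_bounded assms(1) by blast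
  let ?E = "{N+k+m+1..<N+k+m+1 + (c - card {i. F i})}"
  have "{i. F i \<or> i \<in> ?E} = {i. F i} \<union> ?E" by auto
  moreover have "card ({i. F i} \<union> ?E) = c"
    using assms N by (subst card_Un_disjoint) (auto simp: subset_iff)
  ultimately show ?thesis using assms by (intro exI[of _ "\<lambda>i. F i \<or> i \<in> ?E"]) auto
qed

text \<open>If \<open>F\<close> contains \<open>i0\<close>, then the points of the set near
\<open>(B, F)\<close> have first component \<open>{m}\<close> with \<open>m < i0\<close>, and
\<open>m\<close> can be read off from \<open>B\<close>. Hence they all lie in one cluster and differ
from \<open>(B, F)\<close> in the second component only, which must then be strictly larger than
\<open>F\<close>.\<close>

lemma islimpt_rankedD:
  assumes z: "(B, F) islimpt ranked S n"
  shows "(B, F) \<in> ranked S (Suc n)"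
proof (cases "{i. F i} = {}")
  case True
  then show ?thesis by (simp add: ranked_def)
next
  case False
  then obtain i0 where i0: "F i0" by blast
  have near: "\<exists>m G. m \<in> S \<and> m < i0 \<and> (\<lambda>i. i = m, G) \<noteq> (B, F) \<and> finite {i. G i} \<and> {i. G i} \<subseteq> {m<..} \<and>
      card {i. G i} + n \<le> m + 1 \<and> (\<forall>i<k. G i = F i \<and> B i = (i = m))" if k: "i0 < k" for k
  proof -
    obtain B' G where w: "(B', G) \<in> ranked S n" "(B', G) \<noteq> (B, F)" "(B', G) \<in> cylinder k (B, F)"
      using z unfolding islimpt_iff_cylinder by (metis surj_pair)
    have G: "G i0" using w(3) k i0 by (auto simp: cylinder_def)
    then obtain m where m: "m \<in> S" "B' = (\<lambda>i. i = m)" "finite {i. G i}" "{i. G i} \<subseteq> {m<..}"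
      "card {i. G i} + n \<le> m + 1"
      using w(1) unfolding ranked_def by auto
    have "m < i0" using G m(4) by auto
    moreover have "\<forall>i<k. G i = F i \<and> B i = (i = m)" using w(3) m(2) by (auto simp: cylinder_def)
    ultimately show ?thesis using m w(2) by (intro exI[of _ m] exI[of _ G]) simp
  qed
  obtain m where m: "m \<in> S" "m < i0" "B m" using near[of "Suc i0"] by auto
  have near': "\<exists>G. (\<lambda>i. i = m, G) \<noteq> (B, F) \<and> finite {i. G i} \<and> {i. G i} \<subseteq> {m<..} \<and>
      card {i. G i} + n \<le> m + 1 \<and> (\<forall>i<k. G i = F i \<and> B i = (i = m))" if k: "i0 < k" for k
  proof -
    obtain m' G where G: "m' < i0" "(\<lambda>i. i = m', G) \<noteq> (B, F)" "finite {i. G i}" "{i. G i} \<subseteq> {m'<..}"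
      "card {i. G i} + n \<le> m' + 1" "\<forall>i<k. G i = F i \<and> B i = (i = m')"
      using near[OF k] by blast
    have "m < k" using m(2) k by simp
    then have "m = m'" using G(6) m(3) by blast
    then show ?thesis using G by blast
  qed
  have B: "B = (\<lambda>i. i = m)"
  proof
    fix j show "B j = (j = m)" using near'[of "Suc (i0 + j)"] by auto
  qed
  have near'': "\<exists>G. G \<noteq> F \<and> finite {i. G i} \<and> card {i. G i} + n \<le> m + 1 \<and> {i. G i} \<subseteq> {m<..} \<and> (\<forall>i<k. G i = F i)"
    for k
  proof -
    have "i0 < Suc (i0 + k)" by simp
    from near'[OF this] obtain G where G: "(\<lambda>i. i = m, G) \<noteq> (B, F)" "finite {i. G i}" "{i. G i} \<subseteq> {m<..}"
      "card {i. G i} + n \<le> m + 1" "\<forall>i<Suc (i0 + k). G i = F i \<and> B i = (i = m)"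
      by (elim exE conjE)
    have "G \<noteq> F" using G(1) B by simp
    moreover have "\<forall>i<k. G i = F i" using G(5) by simp
    ultimately show ?thesis using G(2-4) by (intro exI[of _ G] conjI)
  qed
  have gt: "{i. F i} \<subseteq> {m<..}"
  proof
    fix i assume "i \<in> {i. F i}"
    then show "i \<in> {m<..}" using near''[of "Suc i"] by auto
  qed
  have fin: "finite {i. F i}"
  proof (rule ccontr)
    assume "infinite {i. F i}"
    then obtain A where A: "finite A" "card A = m + 2" "A \<subseteq> {i. F i}"
      using infinite_arbitrarily_large by blast
    obtain k where k: "A \<subseteq> {..<k}" using finite_nat_bounded[OF A(1)] by blast
    obtain G where G: "finite {i. G i}" "card {i. G i} + n \<le> m + 1" "\<forall>i<k. G i = F i"
      using near''[of k] by blast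
    have "A \<subseteq> {i. G i}" using A(3) k G(3) by auto
    then have "card A \<le> card {i. G i}" using G(1) card_mono by blast
    then show False using A(2) G(2) by simp
  qed
  obtain k where k: "{i. F i} \<subseteq> {..<k}" using finite_nat_bounded[OF fin] by blast
  obtain G where G: "G \<noteq> F" "finite {i. G i}" "card {i. G i} + n \<le> m + 1" "\<forall>i<k. G i = F i"
    using near''[of k] by blast
  have "{i. F i} \<subseteq> {i. G i}" using k G(4) by auto
  moreover have "{i. F i} \<noteq> {i. G i}" using G(1) by auto
  ultimately have "{i. F i} \<subset> {i. G i}" by blast
  then have "card {i. F i} < card {i. G i}" using G(2) psubset_card_mono by blast
  then have "card {i. F i} + Suc n \<le> m + 1" using G(3) by linarith
  then show ?thesis using m(1) B fin gt unfolding ranked_def by blast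
qed

text \<open>A kernel point is approached by changing its first component far out, a scattered point
by adding a far element to its second component.\<close>

lemma islimpt_rankedI:
  assumes z: "(B, F) \<in> ranked S (Suc n)"
  shows "(B, F) islimpt ranked S n"
  unfolding islimpt_iff_cylinder
proof
  fix k
  show "\<exists>w\<in>ranked S n. w \<noteq> (B, F) \<and> w \<in> cylinder k (B, F)"
  proof (cases "{i. F i} = {}")
    case True
    then have "(B(k := \<not> B k), F) \<in> ranked S n" by (simp add: ranked_def)
    moreover have "B(k := \<not> B k) \<noteq> B" by (metis fun_upd_same)
    ultimately show ?thesis
      by (intro bexI[of _ "(B(k := \<not> B k), F)"]) (auto simp: cylinder_def)
  next
    case False
    then obtain m where m: "m \<in> S" "B = (\<lambda>i. i = m)" "finite {i. F i}" "{i. F i} \<subseteq> {m<..}"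
      "card {i. F i} + Suc n \<le> m + 1"
      using z unfolding ranked_def by blast
    obtain G where G: "finite {i. G i}" "{i. G i} \<subseteq> {m<..}" "card {i. G i} = card {i. F i} + 1" "\<forall>i<k. G i = F i"
      using add_far_elements[OF m(3,4), of "card {i. F i} + 1" k] by auto
    have "(B, G) \<in> ranked S n" using m G unfolding ranked_def by auto
    moreover have "G \<noteq> F" using G(3) by auto
    ultimately show ?thesis using G(4) by (intro bexI[of _ "(B, G)"]) (auto simp: cylinder_def)
  qed
qed

lemma islimpt_ranked: "z islimpt ranked S n \<longleftrightarrow> z \<in> ranked S (Suc n)"
  by (metis islimpt_rankedD islimpt_rankedI surj_pair)

lemma ranked_antimono: "n \<le> m \<Longrightarrow> ranked S m \<subseteq> ranked S n"
  unfolding ranked_def by fastforce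

lemma closed_ranked: "closed (ranked S n)"
  unfolding closed_limpt islimpt_ranked using ranked_antimono[of n "Suc n" S] by auto

lemma derived_set_of_top_of_set:
  fixes M A :: "'a::topological_space set"
  shows "top_of_set M derived_set_of A = {z\<in>M. z islimpt (M \<inter> A)}"
proof -
  have "euclidean derived_set_of B = {z. z islimpt B}" for B :: "'a set"
    unfolding derived_set_of_def islimpt_def Bex_def by (simp add: conj_ac imp_conjL) metis
  then show ?thesis by (auto simp: derived_set_of_subtopology)
qed

lemma CB_derivative_ranked: "CB_derivative (top_of_set (ranked S 0)) n = ranked S n"
proof (induction n)
  case (Suc n)
  have "ranked S 0 \<inter> ranked S n = ranked S n" "ranked S (Suc n) \<subseteq> ranked S 0"
    using ranked_antimono[of 0 n S] ranked_antimono[of 0 "Suc n" S] by auto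
  then show ?case by (auto simp: Suc derived_set_of_top_of_set islimpt_ranked)
qed simp

text \<open>A kernel point that is a limit of points of rank \<open>n\<close> is a limit of points
in clusters with \<open>m \<ge> n\<close>. As \<open>n\<close> is not in \<open>S\<close> one has
\<open>m > n\<close>, so these points have a second component with at least two elements, and
removing one gives nearby points of rank \<open>n + 1\<close>. A scattered point that is a limit of
points of rank \<open>n\<close> has rank at least \<open>n + 1\<close>, and adding far elements
brings it down to exactly \<open>n + 1\<close>.\<close>

lemma exact_rank_islimptD:
  assumes z: "(B, F) islimpt exact_rank S n" and n: "n \<notin> S"
  shows "(B, F) \<in> closure (exact_rank S (Suc n))"
proof -
  have "(B, F) islimpt ranked S n"
    using z islimpt_subset by (metis Diff_subset exact_rank_eq)
  then have r: "(B, F) \<in> ranked S (Suc n)" using islimpt_ranked by blast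
  have "\<exists>w\<in>exact_rank S (Suc n). w \<in> cylinder k (B, F)" for k
  proof (cases "{i. F i} = {}")
    case True
    obtain m G where G: "m \<in> S" "(\<lambda>i. i = m, G) \<in> cylinder k (B, F)" "finite {i. G i}" "{i. G i} \<noteq> {}"
      "{i. G i} \<subseteq> {m<..}" "card {i. G i} + n = m + 1"
      using z unfolding islimpt_iff_cylinder exact_rank_def by fast
    obtain g where g: "G g" using G(4) by blast
    have "card {i. G i} \<noteq> 0" using G(3,4) by simp
    then have "m > n" using n G(1,6) by (cases "m = n") auto
    then have c: "card ({i. G i} - {g}) + Suc n = m + 1" "card ({i. G i} - {g}) \<noteq> 0"
      using G(3,6) g by auto
    have e: "{i. G i \<and> i \<noteq> g} = {i. G i} - {g}" by auto
    have "(\<lambda>i. i = m, \<lambda>i. G i \<and> i \<noteq> g) \<in> exact_rank S (Suc n)"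
      unfolding exact_rank_def mem_Collect_eq case_prod_conv e
      using G c by (intro conjI bexI[of _ m]) auto
    moreover have "(\<lambda>i. i = m, \<lambda>i. G i \<and> i \<noteq> g) \<in> cylinder k (B, F)"
      using G(2) True by (auto simp: cylinder_def)
    ultimately show ?thesis by blast
  next
    case False
    then obtain m where m: "m \<in> S" "B = (\<lambda>i. i = m)" "finite {i. F i}" "{i. F i} \<subseteq> {m<..}"
      "card {i. F i} + Suc n \<le> m + 1"
      using r unfolding ranked_def by blast
    have "card {i. F i} \<le> m - n" using m(5) by simp
    from add_far_elements[OF m(3,4) this, of k]
    obtain G where G: "finite {i. G i}" "{i. G i} \<subseteq> {m<..}" "card {i. G i} = m - n" "\<forall>i<k. G i = F i"
      by (elim exE conjE)
    have "card {i. F i} \<noteq> 0" using m(3) False by simp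
    then have "card {i. G i} + Suc n = m + 1" "card {i. G i} \<noteq> 0" using m(5) G(3) by auto
    moreover from this(2) have "{i. G i} \<noteq> {}" by (metis card.empty)
    ultimately have "(B, G) \<in> exact_rank S (Suc n)"
      unfolding exact_rank_def mem_Collect_eq case_prod_conv
      using G(1,2) m(1,2) by (intro conjI bexI[of _ m])
    then show ?thesis using G(4) by (intro bexI[of _ "(B, G)"]) (auto simp: cylinder_def)
  qed
  then show ?thesis using closure_iff_cylinder by blast
qed

text \<open>Near \<open>({n}, {})\<close> all scattered points belong to the cluster of
\<open>n\<close>, in which no rank exceeds \<open>n\<close>.\<close>

lemma exact_rank_islimptI:
  assumes n: "n \<in> S"
  shows "(\<lambda>i. i = n, \<lambda>i. False) islimpt exact_rank S n"
    and "(\<lambda>i. i = n, \<lambda>i. False) \<notin> closure (exact_rank S (Suc n))"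
proof -
  show "(\<lambda>i. i = n, \<lambda>i. False) islimpt exact_rank S n"
    unfolding islimpt_iff_cylinder
  proof
    fix k
    have "(\<lambda>i. i = n, \<lambda>i. i = k + n + 1) \<in> exact_rank S n"
      using n by (auto simp: exact_rank_def)
    moreover have "(\<lambda>i. i = k + n + 1) \<noteq> (\<lambda>i. False)" by metis
    ultimately show "\<exists>w\<in>exact_rank S n. w \<noteq> (\<lambda>i. i = n, \<lambda>i. False) \<and> w \<in> cylinder k (\<lambda>i. i = n, \<lambda>i. False)"
      by (intro bexI[of _ "(\<lambda>i. i = n, \<lambda>i. i = k + n + 1)"]) (auto simp: cylinder_def)
  qed
  have "\<not> (\<exists>w\<in>exact_rank S (Suc n). w \<in> cylinder (Suc n) (\<lambda>i. i = n, \<lambda>i. False))"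
    by (auto simp: cylinder_def exact_rank_def)
  then show "(\<lambda>i. i = n, \<lambda>i. False) \<notin> closure (exact_rank S (Suc n))"
    unfolding closure_iff_cylinder by blast
qed

lemma CB_spectrum_ranked: "CB_spectrum (top_of_set (ranked S 0)) = S"
proof -
  let ?M = "ranked S 0"
  have L: "CB_level (top_of_set ?M) n = exact_rank S n" for n
    by (simp only: CB_level_def CB_derivative_ranked exact_rank_eq)
  have sub: "exact_rank S n \<subseteq> ?M" for n
    using ranked_antimono[of 0 n S] exact_rank_eq[of S n] by auto
  have cl: "top_of_set ?M closure_of exact_rank S n = closure (exact_rank S n)" for n
    using closure_minimal[OF sub closed_ranked] sub
    by (auto simp: closure_of_subtopology Int_absorb1)
  have lim: "z \<in> ?M" if "z islimpt exact_rank S n" for z n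
    using islimpt_subset[OF that sub] closed_ranked[of S 0] unfolding closed_limpt by metis
  have "n \<in> CB_spectrum (top_of_set ?M) \<longleftrightarrow> (\<exists>z. z islimpt exact_rank S n \<and> z \<notin> closure (exact_rank S (Suc n)))" for n
    using lim by (auto simp: CB_spectrum_def L cl derived_set_of_top_of_set Int_absorb1[OF sub])
  also have "\<dots> n \<longleftrightarrow> n \<in> S" for n
    using exact_rank_islimptD exact_rank_islimptI by (metis surj_pair)
  finally show ?thesis by blast
qed

section \<open>Embedding the compact spaces in a line\<close>

text \<open>The digits 0 and 1 in base 3 give an embedding of binary sequences in the real line,
because a tail of the geometric series with ratio 1/3 is smaller than the term before it.\<close>

definition ternary_sum :: "(nat \<Rightarrow> bool) \<Rightarrow> real" where
  "ternary_sum f = (\<Sum>i. of_bool (f i) * (1/3) ^ i)"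

lemma summable_ternary: "summable (\<lambda>i. of_bool (f i) * (1/3::real) ^ i)"
  by (rule summable_comparison_test'[of "\<lambda>i. (1/3::real) ^ i" 0]) (auto simp: summable_geometric)

lemma continuous_ternary_sum: "continuous_on UNIV ternary_sum"
proof -
  let ?s = "\<lambda>i (f :: nat \<Rightarrow> bool). of_bool (f i) * (1/3::real) ^ i"
  have "uniform_limit UNIV (\<lambda>n f. \<Sum>i<n. ?s i f) (\<lambda>f. \<Sum>i. ?s i f) sequentially"
    by (rule Weierstrass_m_test[of _ _ "\<lambda>i. (1/3::real) ^ i"]) (auto simp: summable_geometric)
  moreover have "continuous_on UNIV (?s i)" for i
  proof -
    have "continuous_on UNIV (\<lambda>f :: nat \<Rightarrow> bool. of_bool (f i) :: real)"
      by (rule continuous_on_compose2[OF Topological_Spaces.continuous_on_discrete continuous_on_product_coordinates, where t=UNIV]) simp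
    then show ?thesis by (intro continuous_intros)
  qed
  then have "continuous_on UNIV (\<lambda>f. \<Sum>i<n. ?s i f)" for n by (intro continuous_on_sum)
  ultimately have "continuous_on UNIV (\<lambda>f. \<Sum>i. ?s i f)"
    by (intro uniform_limit_theorem[where F = sequentially]) auto
  then show ?thesis by (simp add: ternary_sum_def [abs_def])
qed

lemma inj_ternary_sum: "inj ternary_sum"
proof -
  have less: "ternary_sum g < ternary_sum f" if eq: "\<forall>j<i. f j = g j" and fi: "f i" and gi: "\<not> g i" for f g i
  proof -
    let ?t = "\<lambda>(f :: nat \<Rightarrow> bool) j. of_bool (f (j + Suc i)) * (1/3::real) ^ (j + Suc i)"
    have split: "ternary_sum f = (\<Sum>j. ?t f j) + (\<Sum>j<Suc i. of_bool (f j) * (1/3) ^ j)" for f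
      unfolding ternary_sum_def by (rule suminf_split_initial_segment[OF summable_ternary])
    have sm: "summable (?t f)" for f
      using summable_ternary[of f] by (subst summable_iff_shift)
    have "(\<Sum>j. ?t f j) \<ge> 0" by (intro suminf_nonneg sm) auto
    moreover have "(\<Sum>j. ?t g j) \<le> (\<Sum>j. (1/3) ^ Suc i * (1/3::real) ^ j)"
      by (intro suminf_le sm summable_mult summable_geometric) (auto simp: power_add mult_ac)
    moreover have "(\<Sum>j. (1/3) ^ Suc i * (1/3::real) ^ j) = (1/3) ^ i / 2"
      by (subst suminf_mult) (auto simp: suminf_geometric summable_geometric)
    moreover have "(\<Sum>j<i. of_bool (f j) * (1/3::real) ^ j) = (\<Sum>j<i. of_bool (g j) * (1/3) ^ j)"
      using eq by (intro sum.cong) auto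
    moreover have "(1/3::real) ^ i > 0" by simp
    ultimately show ?thesis
      using fi gi by (simp only: split sum.lessThan_Suc of_bool_eq)
  qed
  show ?thesis
  proof (rule injI, rule ccontr)
    fix f g assume fg: "ternary_sum f = ternary_sum g" "f \<noteq> g"
    define i where "i = (LEAST i. f i \<noteq> g i)"
    have "\<exists>i. f i \<noteq> g i" using fg(2) by auto
    then have "f i \<noteq> g i" unfolding i_def by (rule LeastI_ex)
    moreover have "\<forall>j<i. f j = g j" using not_less_Least unfolding i_def by blast
    ultimately show False using less[of i f g] less[of i g f] fg(1) by (cases "f i") auto
  qed
qed

definition interleave :: "(nat \<Rightarrow> bool) \<times> (nat \<Rightarrow> bool) \<Rightarrow> nat \<Rightarrow> bool" where
  "interleave z i = (if even i then fst z (i div 2) else snd z (i div 2))"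

definition cantor_code :: "(nat \<Rightarrow> bool) \<times> (nat \<Rightarrow> bool) \<Rightarrow> real" where
  "cantor_code z = ternary_sum (interleave z)"

lemma continuous_interleave: "continuous_on UNIV interleave"
proof (rule continuous_on_coordinatewise_then_product)
  fix i
  have "continuous_on UNIV (\<lambda>z :: (nat \<Rightarrow> bool) \<times> (nat \<Rightarrow> bool). fst z j)" for j
    by (rule continuous_on_compose2[OF continuous_on_product_coordinates[of j] continuous_on_fst[OF continuous_on_id]]) simp
  moreover have "continuous_on UNIV (\<lambda>z :: (nat \<Rightarrow> bool) \<times> (nat \<Rightarrow> bool). snd z j)" for j
    by (rule continuous_on_compose2[OF continuous_on_product_coordinates[of j] continuous_on_snd[OF continuous_on_id]]) simp
  ultimately show "continuous_on UNIV (\<lambda>z. interleave z i)"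
    by (cases "even i") (auto simp: interleave_def)
qed

lemma inj_interleave: "inj interleave"
proof (rule injI)
  fix z w assume h: "interleave z = interleave w"
  have "fst z i = fst w i" "snd z i = snd w i" for i
    using fun_cong[OF h, of "2 * i"] fun_cong[OF h, of "2 * i + 1"] by (auto simp: interleave_def)
  then show "z = w" by (auto simp: prod_eq_iff)
qed

lemma continuous_cantor_code: "continuous_on UNIV cantor_code"
  unfolding cantor_code_def [abs_def]
  by (rule continuous_on_compose2[OF continuous_ternary_sum continuous_interleave]) simp

lemma inj_cantor_code: "inj cantor_code"
  using inj_compose[OF inj_ternary_sum inj_interleave] by (simp add: comp_def cantor_code_def [abs_def])

lemma compact_sequence_pairs: "compact (UNIV :: ((nat \<Rightarrow> bool) \<times> (nat \<Rightarrow> bool)) set)"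
proof -
  have "compact_space (euclidean :: bool topology)"
    unfolding compact_space_def by (intro finite_imp_compactin) auto
  then have "compact_space (product_topology (\<lambda>_ :: nat. euclidean :: bool topology) UNIV)"
    by (simp add: compact_space_product_topology)
  then have "compact (UNIV :: (nat \<Rightarrow> bool) set)"
    by (simp add: euclidean_product_topology compact_space_def)
  from compact_Times[OF this this] show ?thesis by simp
qed

text \<open>On an interval inside the range, every binary coordinate of the inverse would be a
continuous function with values 0 and 1, hence constant, against injectivity.\<close>

lemma no_interval_range_cantor_code: "no_interval (range cantor_code)"
  unfolding no_interval_def
proof (intro allI impI)
  fix u v :: real assume uv: "u < v"
  show "\<exists>t>u. t < v \<and> t \<notin> range cantor_code"
  proof (rule ccontr)
    assume "\<not> ?thesis"
    then have sub: "{u<..<v} \<subseteq> range cantor_code" by auto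
    let ?K = "inv cantor_code"
    have "continuous_on (range cantor_code) ?K"
      using inj_cantor_code by (intro continuous_on_inv[OF continuous_cantor_code compact_sequence_pairs]) simp
    then have K: "continuous_on {u<..<v} ?K" using sub continuous_on_subset by blast
    have IK: "continuous_on {u<..<v} (\<lambda>t. interleave (?K t))"
      by (rule continuous_on_compose2[OF continuous_interleave K]) simp
    obtain s t where st: "u < s" "s < t" "t < v" using dense uv by meson
    have "cantor_code (?K s) = s" "cantor_code (?K t) = t" using sub st by (auto simp: f_inv_into_f subset_iff)
    then have "interleave (?K s) \<noteq> interleave (?K t)" using st(2) by (auto simp: cantor_code_def)
    then obtain i where i: "interleave (?K s) i \<noteq> interleave (?K t) i" by auto
    let ?c = "\<lambda>t. of_bool (interleave (?K t) i) :: real"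
    have "continuous_on {u<..<v} (\<lambda>t. interleave (?K t) i)"
      by (rule continuous_on_compose2[OF continuous_on_product_coordinates IK]) simp
    then have "continuous_on {u<..<v} ?c"
      by (intro continuous_on_compose2[OF Topological_Spaces.continuous_on_discrete[of UNIV "of_bool :: bool \<Rightarrow> real"]]) auto
    moreover have "finite (?c ` {u<..<v})"
      by (rule finite_subset[of _ "{0,1}"]) auto
    ultimately have "?c constant_on {u<..<v}"
      by (intro continuous_finite_range_constant connected_Ioo)
    then obtain a where a: "\<forall>x\<in>{u<..<v}. ?c x = a" unfolding constant_on_def by (elim exE)
    have "?c s = a" "?c t = a" by (rule a[rule_format], use st in simp)+
    then show False using i by (metis of_bool_eq_iff)
  qed
qed

text \<open>One end of the complement of a compact subset of Euclidean space is the point at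
infinity, which is isolated among the ends. To have the space of ends equal to \<open>ranked S
0\<close>, an isolated point of this set is removed from the line and takes the place of infinity.
If \<open>S\<close> contains 0, the points \<open>({0}, {i})\<close> with \<open>i > 0\<close> are
isolated; the one with \<open>i = 1\<close> is chosen.\<close>

definition isolated_end :: "(nat \<Rightarrow> bool) \<times> (nat \<Rightarrow> bool)" where
  "isolated_end = (\<lambda>i. i = 0, \<lambda>i. i = 1)"

definition line_set :: "nat set \<Rightarrow> real set" where
  "line_set S = cantor_code ` (ranked S 0 - {isolated_end})"

lemma isolated_end_isolated:
  assumes "0 \<in> S"
  shows "ranked S 0 \<inter> cylinder 2 isolated_end = {isolated_end}"
proof (rule antisym; rule subsetI)
  fix z assume z: "z \<in> ranked S 0 \<inter> cylinder 2 isolated_end"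
  obtain B F where BF: "z = (B, F)" by (metis surj_pair)
  have F1: "F 1" using z BF by (auto simp: cylinder_def isolated_end_def)
  then have "{i. F i} \<noteq> {}" by auto
  then obtain m where m: "B = (\<lambda>i. i = m)" "finite {i. F i}" "{i. F i} \<subseteq> {m<..}" "card {i. F i} + 0 \<le> m + 1"
    using z BF unfolding ranked_def by auto
  have "m = 0" using F1 m(3) by auto
  then have "card {i. F i} \<le> card {1::nat}" using m(4) by simp
  moreover have "{1} \<subseteq> {i. F i}" using F1 by simp
  ultimately have "{i. F i} = {1}" using m(2) card_seteq by metis
  then have "F = (\<lambda>i. i = 1)" by auto
  then show "z \<in> {isolated_end}" using BF m(1) \<open>m = 0\<close> by (simp add: isolated_end_def)
next
  fix z assume "z \<in> {isolated_end}"
  then show "z \<in> ranked S 0 \<inter> cylinder 2 isolated_end"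
    using assms by (auto simp: isolated_end_def ranked_def cylinder_def)
qed

lemma compact_line_set:
  assumes "0 \<in> S"
  shows "compact (line_set S)"
proof -
  have "ranked S 0 - {isolated_end} = UNIV \<inter> (ranked S 0 \<inter> - cylinder 2 isolated_end)"
    using isolated_end_isolated[OF assms] by auto
  then have "compact (ranked S 0 - {isolated_end})"
    using compact_Int_closed[OF compact_sequence_pairs closed_Int[OF closed_ranked closed_Compl[OF open_cylinder]]]
    by simp
  then show ?thesis
    unfolding line_set_def using continuous_on_subset[OF continuous_cantor_code subset_UNIV]
    by (intro compact_continuous_image)
qed

lemma no_interval_line_set: "no_interval (line_set S)"
  using no_interval_range_cantor_code unfolding no_interval_def line_set_def by blast

lemma ranked_homeomorphic_ends:
  fixes e :: "'e::euclidean_space"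
  assumes S: "0 \<in> S" and e: "e \<noteq> 0"
  shows "top_of_set (ranked S 0) homeomorphic_space
    subtopology (Alexandroff_compactification euclidean) (insert None (Some ` (\<lambda>t. t *\<^sub>R e) ` line_set S))"
    (is "_ homeomorphic_space subtopology ?X ?P")
proof -
  let ?M = "ranked S 0"
  define f where "f = (\<lambda>z. if z = isolated_end then None else Some (cantor_code z *\<^sub>R e))"
  have img: "f ` ?M = ?P"
    using isolated_end_isolated[OF S] by (auto simp: f_def line_set_def image_image)
  have inj: "inj_on f ?M"
    using inj_cantor_code e by (auto simp: inj_on_def f_def)
  have "continuous_map (top_of_set ?M) ?X f"
    unfolding continuous_map_def
  proof (intro conjI allI impI)
    show "f \<in> topspace (top_of_set ?M) \<rightarrow> topspace ?X" by (auto simp: f_def)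
    fix T assume T: "openin ?X T"
    have cont: "continuous_on UNIV (\<lambda>z. cantor_code z *\<^sub>R e)"
      using continuous_cantor_code by (intro continuous_intros)
    have "open {x. Some x \<in> T}" using Alexandroff_open_vimage[OF T] .
    then have "open ((\<lambda>z. cantor_code z *\<^sub>R e) -` {x. Some x \<in> T})" using cont open_vimage by blast
    moreover have "open (cantor_code -` (- {cantor_code isolated_end}))"
      using open_vimage[OF _ continuous_cantor_code] by blast
    ultimately have o: "open ((\<lambda>z. cantor_code z *\<^sub>R e) -` {x. Some x \<in> T} \<inter> cantor_code -` (- {cantor_code isolated_end}))"
      (is "open ?O") by (rule open_Int)
    have ni: "cantor_code z \<noteq> cantor_code isolated_end \<longleftrightarrow> z \<noteq> isolated_end" for z
      using inj_cantor_code by (auto simp: inj_eq)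
    have iso: "isolated_end \<in> ?M" "\<And>z. z \<in> ?M \<Longrightarrow> z \<in> cylinder 2 isolated_end \<longleftrightarrow> z = isolated_end"
      using isolated_end_isolated[OF S] by auto
    have "{z \<in> ?M. f z \<in> T} = ?M \<inter> (?O \<union> (if None \<in> T then cylinder 2 isolated_end else {}))"
      using iso ni by (auto simp: f_def self_in_cylinder)
    moreover have "open (?O \<union> (if None \<in> T then cylinder 2 isolated_end else {}))"
      by (intro open_Un o) (simp add: open_cylinder)
    ultimately show "openin (top_of_set ?M) {z \<in> topspace (top_of_set ?M). f z \<in> T}"
      by (simp add: openin_open_Int)
  qed
  then have "continuous_map (top_of_set ?M) (subtopology ?X ?P) f"
    using img by (auto simp: continuous_map_in_subtopology)
  moreover have "compact_space (top_of_set ?M)"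
    using compact_Int_closed[OF compact_sequence_pairs closed_ranked]
    by (simp add: compact_space_subtopology)
  moreover have "Hausdorff_space (subtopology ?X ?P)"
  proof -
    have "locally_compact_space (euclidean :: 'e topology)"
      using locally_compact_UNIV locally_compact_space_euclidean by blast
    then show ?thesis
      by (simp add: Hausdorff_space_Alexandroff_compactification Hausdorff_space_subtopology)
  qed
  ultimately have "homeomorphic_map (top_of_set ?M) (subtopology ?X ?P) f"
    using img inj by (intro continuous_imp_homeomorphic_map) auto
  then show ?thesis by (rule homeomorphic_map_imp_homeomorphic_space)
qed

section \<open>Euclidean domains as manifolds\<close>

text \<open>The derivatives in \<open>Ck_on\<close> are full derivatives, so that only openness of
\<open>S\<close> makes them depend on the values in \<open>S\<close> alone.\<close>

lemma Ck_on_cong: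
  assumes "open S" "\<And>x. x \<in> S \<Longrightarrow> f x = g x" "Ck_on k S f"
  shows "Ck_on k S g"
  using assms(2,3)
proof (induction k arbitrary: f g)
  case 0
  then show ?case using continuous_on_cong by (metis Ck_on.simps(1))
next
  case (Suc k)
  have d: "(g has_derivative frechet_derivative f (at x)) (at x)" if "x \<in> S" for x
  proof -
    have "f differentiable at x" using Suc.prems(2) that by simp
    then have "(f has_derivative frechet_derivative f (at x)) (at x)"
      using frechet_derivative_works by blast
    then show ?thesis
      using has_derivative_transform_within_open[OF _ assms(1) that] Suc.prems(1) by blast
  qed
  have "Ck_on k S (\<lambda>x. frechet_derivative g (at x) v)" for v
  proof (rule Suc.IH)
    show "Ck_on k S (\<lambda>x. frechet_derivative f (at x) v)" using Suc.prems(2) by simp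
    show "frechet_derivative f (at x) v = frechet_derivative g (at x) v" if "x \<in> S" for x
      using frechet_derivative_at[OF d[OF that]] by simp
  qed
  moreover have "g differentiable at x" if "x \<in> S" for x
    using d[OF that] by (rule differentiableI)
  ultimately show ?case by simp
qed

lemma Ck_on_const: "Ck_on k S (\<lambda>_. c)"
  by (induction k arbitrary: c) (simp_all add: frechet_derivative_const)

lemma Ck_on_id: "Ck_on k S (\<lambda>x. x)"
  by (cases k) (simp_all add: Ck_on_const frechet_derivative_ident)

lemma smooth_on_eq_id:
  assumes "open S" "\<And>x. x \<in> S \<Longrightarrow> f x = x"
  shows "smooth_on S f"
  unfolding smooth_on_def using Ck_on_cong[OF assms(1), of "\<lambda>x. x" f] Ck_on_id assms(2) by metis

text \<open>The manifold with one chart that carries a Euclidean domain \<open>U\<close> over to the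
point type \<open>'a\<close> along an injection \<open>j\<close>.\<close>

definition transported_domain :: "('e \<Rightarrow> 'a) \<Rightarrow> 'e::euclidean_space set \<Rightarrow> ('a, 'e) pre_manifold" where
  "transported_domain j U = (pullback_topology (j ` U) (inv j) euclidean, {(j ` U, inv j)})"

lemma topspace_transported_domain [simp]: "topspace (fst (transported_domain j U)) = j ` U"
  by (simp add: transported_domain_def topspace_pullback_topology)

lemma homeomorphic_map_transported_domain:
  assumes j: "inj j"
  shows "homeomorphic_map (fst (transported_domain j U)) (top_of_set U) (inv j)"
proof -
  let ?Y = "fst (transported_domain j U)"
  have ij: "inv j (j x) = x" for x using j by simp
  have "continuous_map ?Y euclidean (id \<circ> inv j)"
    unfolding transported_domain_def fst_conv by (intro continuous_map_pullback continuous_map_id)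
  then have 1: "continuous_map ?Y (top_of_set U) (inv j)"
    using ij by (auto simp: continuous_map_in_subtopology)
  have "inv j \<circ> j = id" using ij by auto
  then have 2: "continuous_map (top_of_set U) ?Y j"
    unfolding transported_domain_def fst_conv by (intro continuous_map_pullback') auto
  have "homeomorphic_maps ?Y (top_of_set U) (inv j) j"
    unfolding homeomorphic_maps_def using 1 2 ij by auto
  then show ?thesis using homeomorphic_maps_map by blast
qed

lemma transported_domain_homeomorphic:
  "inj j \<Longrightarrow> fst (transported_domain j U) homeomorphic_space top_of_set U"
  using homeomorphic_map_transported_domain homeomorphic_map_imp_homeomorphic_space by blast

lemma inv_transport_id:
  assumes "inj j" "x \<in> U"
  shows "inv j (inv_into (j ` U) (inv j) x) = x"
proof -
  have "x \<in> inv j ` j ` U" using assms by (auto simp: image_image)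
  then show ?thesis by (rule f_inv_into_f)
qed

lemma second_countable_euclidean_space: "second_countable (euclidean :: 'b::second_countable_topology topology)"
proof -
  obtain B :: "'b set set" where B: "countable B" "topological_basis B"
    using ex_countable_basis by blast
  show ?thesis
    unfolding second_countable_def
  proof (intro exI[of _ B] conjI ballI allI impI)
    show "openin euclidean V" if "V \<in> B" for V using topological_basis_open[OF B(2) that] by simp
    show "\<exists>V\<in>B. x \<in> V \<and> V \<subseteq> U" if "openin euclidean U \<and> x \<in> U" for U x
      using topological_basisE[OF B(2)] that by (metis open_openin)
  qed (rule B(1))
qed

lemma open_manifold_transported_domain:
  assumes j: "inj j" and U: "open U" "connected U" "\<not> compact U"
  shows "open_manifold (transported_domain j U)"
proof -
  let ?Y = "fst (transported_domain j U)"
  note h = transported_domain_homeomorphic[OF j, of U]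
  have im: "inv j ` j ` V = V" for V using j by (simp add: image_image)
  have "Hausdorff_space ?Y"
    using homeomorphic_Hausdorff_space[OF h] by (simp add: Hausdorff_space_subtopology)
  moreover have "second_countable ?Y"
    using homeomorphic_space_second_countability[OF h] second_countable_subtopology[OF second_countable_euclidean_space] by blast
  moreover have "is_chart ?Y (j ` U, inv j)"
    unfolding is_chart_def case_prod_conv im
    using homeomorphic_map_transported_domain[OF j, of U] U(1)
    by (metis openin_topspace subtopology_topspace topspace_transported_domain)
  moreover have "smoothly_compatible (j ` U, inv j) (j ` U, inv j)"
    unfolding smoothly_compatible_def case_prod_conv Int_absorb im
    using smooth_on_eq_id[OF U(1)] inv_transport_id[OF j] by simp
  ultimately have "smooth_manifold (transported_domain j U)"
    unfolding smooth_manifold_def smooth_atlas_def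
    by (auto simp: transported_domain_def topspace_pullback_topology)
  moreover have "connected_space ?Y"
    using homeomorphic_connected_space[OF h] U(2) by (simp add: connected_space_subtopology)
  moreover have "\<not> compact_space ?Y"
    using homeomorphic_compact_space[OF h] U(3) by (simp add: compact_space_def compactin_subtopology)
  ultimately show ?thesis by (simp add: open_manifold_def)
qed

lemma diffeomorphic_transported_domain_refl:
  assumes j: "inj j" and U: "open U"
  shows "diffeomorphic (transported_domain j U) (transported_domain j U)"
proof -
  have "{x \<in> j ` U. x \<in> j ` U} = j ` U" by auto
  then have "smooth_on (inv j ` {x \<in> j ` U. id x \<in> j ` U}) (inv j \<circ> id \<circ> inv_into (j ` U) (inv j))"
    using smooth_on_eq_id[OF U] inv_transport_id[OF j] j by (simp add: image_image)
  then have "smooth_map (transported_domain j U) (transported_domain j U) id"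
    unfolding smooth_map_def transported_domain_def by simp
  then show ?thesis unfolding diffeomorphic_def by (intro exI[of _ id]) simp
qed

lemma diffeomorphic_imp_homeomorphic:
  assumes "diffeomorphic M N"
  shows "fst M homeomorphic_space fst N"
proof -
  obtain X A Y B where MN: "M = (X, A)" "N = (Y, B)" by (metis surj_pair)
  obtain f g where fg: "smooth_map M N f" "smooth_map N M g"
    "\<forall>x\<in>topspace (fst M). g (f x) = x" "\<forall>y\<in>topspace (fst N). f (g y) = y"
    using assms unfolding diffeomorphic_def by blast
  then have "homeomorphic_maps (fst M) (fst N) f g"
    by (auto simp: MN homeomorphic_maps_def smooth_map_def)
  then show ?thesis by (auto simp: homeomorphic_space_def)
qed

text \<open>A point is determined by the members of a countable base that contain it.\<close>

lemma euclidean_lepoll_nat_sets: "(UNIV :: 'e::euclidean_space set) \<lesssim> (UNIV :: nat set set)"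
proof -
  obtain B :: "nat \<Rightarrow> 'e set" where B: "inj B" "\<And>n. open (B n)" "\<And>S. open S \<Longrightarrow> \<exists>I. S = \<Union> {B n |n. n \<in> I}"
    by (rule univ_second_countable_sequence, rule that)
  have sep: "{i. x \<in> B i} \<noteq> {i. y \<in> B i}" if "x \<noteq> y" for x y :: 'e
  proof -
    have "open (- {y})" by (intro open_Compl closed_singleton)
    from B(3)[OF this] obtain I where I: "- {y} = \<Union> {B n |n. n \<in> I}" by (elim exE)
    have "x \<in> \<Union> {B n |n. n \<in> I}" unfolding I[symmetric] using that by simp
    then obtain i where i: "i \<in> I" "x \<in> B i" by auto
    then have "B i \<subseteq> - {y}" unfolding I by auto
    then show ?thesis using i(2) by auto
  qed
  then have "inj (\<lambda>x. {i. x \<in> B i})"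
    unfolding inj_def by metis
  then show ?thesis unfolding lepoll_def by (intro exI[of _ "\<lambda>x. {i. x \<in> B i}"]) simp
qed

section \<open>Continuum many open manifolds\<close>

definition punctured_space :: "nat set \<Rightarrow> 'e::euclidean_space \<Rightarrow> 'e set" where
  "punctured_space S e = - (\<lambda>t. t *\<^sub>R e) ` line_set S"

lemma punctured_space_open_connected_noncompact:
  fixes e b :: "'e::euclidean_space"
  assumes eb: "e \<in> Basis" "b \<in> Basis" "e \<noteq> b" and S: "0 \<in> S"
  shows "open (punctured_space S e)" "connected (punctured_space S e)" "\<not> compact (punctured_space S e)"
proof -
  have C: "compact ((\<lambda>t. t *\<^sub>R e) ` line_set S)"
    using compact_line_set[OF S] by (intro compact_continuous_image continuous_intros)
  then show "open (punctured_space S e)"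
    unfolding punctured_space_def by (intro open_Compl compact_imp_closed)
  show "connected (punctured_space S e)"
    using connected_convex_minus_line_set[OF eb no_interval_line_set open_UNIV convex_UNIV]
    by (simp add: punctured_space_def Compl_eq_Diff_UNIV)
  show "\<not> compact (punctured_space S e)"
  proof
    assume "compact (punctured_space S e)"
    from compact_Un[OF this C] have "compact (UNIV :: 'e set)"
      by (simp add: punctured_space_def)
    then show False using not_compact_UNIV by blast
  qed
qed

text \<open>A homeomorphism of the complements gives one of the spaces of ends, and \<open>S\<close>
is the spectrum of the space of ends.\<close>

lemma punctured_space_determines_set:
  fixes e b :: "'e::euclidean_space"
  assumes eb: "e \<in> Basis" "b \<in> Basis" "e \<noteq> b" and S: "0 \<in> S" and T: "0 \<in> T"
    and hom: "top_of_set (punctured_space S e) homeomorphic_space top_of_set (punctured_space T e)"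
  shows "S = T"
proof -
  let ?X = "Alexandroff_compactification (euclidean :: 'e topology)"
  let ?P = "\<lambda>S. insert None (Some ` (\<lambda>t. t *\<^sub>R e) ` line_set S)"
  have ends: "end_compactification ?X (?P S)" if "0 \<in> S" for S
    using end_compactification_line_set[OF eb no_interval_line_set compact_line_set[OF that]] .
  have U: "top_of_set (punctured_space S e) homeomorphic_space subtopology ?X (topspace ?X - ?P S)" for S
  proof -
    let ?U = "punctured_space S e"
    have "homeomorphic_map euclidean (subtopology ?X (range Some)) (Some :: 'e \<Rightarrow> 'e option)"
      using embedding_map_Some[of "euclidean :: 'e topology"] by (simp add: embedding_map_def)
    then have "homeomorphic_map (top_of_set ?U) (subtopology (subtopology ?X (range Some)) (Some ` ?U)) Some"
      by (rule homeomorphic_map_subtopologies) auto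
    moreover have "range Some \<inter> Some ` ?U = topspace ?X - ?P S"
      by (auto simp: punctured_space_def)
    ultimately show ?thesis
      by (metis homeomorphic_map_imp_homeomorphic_space subtopology_subtopology)
  qed
  have "subtopology ?X (topspace ?X - ?P S) homeomorphic_space subtopology ?X (topspace ?X - ?P T)"
    by (rule homeomorphic_space_trans[OF homeomorphic_space_trans[OF U[of S, THEN homeomorphic_space_sym[THEN iffD1]] hom] U])
  then have "subtopology ?X (?P S) homeomorphic_space subtopology ?X (?P T)"
    by (rule homeomorphic_complements_imp_homeomorphic_ends[OF ends[OF S] ends[OF T]])
  then have P: "CB_spectrum (subtopology ?X (?P S)) = CB_spectrum (subtopology ?X (?P T))"
    by (rule CB_spectrum_homeomorphic)
  have e: "e \<noteq> 0" using eb(1) by auto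
  have "CB_spectrum (subtopology ?X (?P S)) = S" if "0 \<in> S" for S
    using CB_spectrum_homeomorphic[OF ranked_homeomorphic_ends[OF that e]] by (simp only: CB_spectrum_ranked)
  then show ?thesis using P S T by metis
qed

theorem proposition1p3:
  assumes "CARD('n::finite) \<ge> 2"
    and "(UNIV :: real set) \<lesssim> (UNIV :: 'a set)"
  shows "(UNIV :: real set) \<lesssim>
    (open_manifold_diffeo_classes :: ('a, real ^ 'n) pre_manifold set set)"
proof -
  have "2 \<le> card (Basis :: (real ^ 'n) set)" using assms(1) by simp
  then obtain E :: "(real ^ 'n) set" where "E \<subseteq> Basis" "card E = 2"
    using obtain_subset_with_card_n by metis
  then obtain e b :: "real ^ 'n" where eb: "e \<in> Basis" "b \<in> Basis" "e \<noteq> b"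
    by (auto simp: card_2_iff)
  have "(UNIV :: (real ^ 'n) set) \<lesssim> (UNIV :: 'a set)"
    using euclidean_lepoll_nat_sets eqpoll_imp_lepoll[OF nat_sets_eqpoll_reals] assms(2) lepoll_trans by metis
  then obtain j :: "real ^ 'n \<Rightarrow> 'a" where j: "inj j" by (auto simp: lepoll_def)
  have "(UNIV :: real set) \<lesssim> (UNIV :: nat set set)"
    using nat_sets_eqpoll_reals eqpoll_sym eqpoll_imp_lepoll by metis
  then obtain A :: "real \<Rightarrow> nat set" where A: "inj A" by (auto simp: lepoll_def)
  \<comment> \<open>Each set must contain 0 to provide the end at infinity.\<close>
  define S where "S = (\<lambda>r. insert 0 (Suc ` A r))"
  have S0: "0 \<in> S r" for r by (simp add: S_def)
  have S_inj: "r = s" if "S r = S s" for r s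
  proof -
    have "{n. Suc n \<in> S r} = A r" for r by (auto simp: S_def)
    then show ?thesis using that A by (metis injD)
  qed
  define M where "M = (\<lambda>r. transported_domain j (punctured_space (S r) e))"
  note dom = punctured_space_open_connected_noncompact[OF eb S0]
  have M: "open_manifold (M r)" for r
    unfolding M_def by (intro open_manifold_transported_domain j dom)
  let ?R = "{(M, N). open_manifold M \<and> open_manifold N \<and> diffeomorphic M N} 
    :: (('a, real ^ 'n) pre_manifold \<times> ('a, real ^ 'n) pre_manifold) set"
  have "r = s" if "?R `` {M r} = ?R `` {M s}" for r s
  proof -
    have "diffeomorphic (M s) (M s)"
      unfolding M_def by (rule diffeomorphic_transported_domain_refl[OF j dom(1)])
    then have "M s \<in> ?R `` {M s}" using M by simp
    then have "M s \<in> ?R `` {M r}" unfolding that .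
    then have "diffeomorphic (M r) (M s)" by simp
    then have "fst (M r) homeomorphic_space fst (M s)" by (rule diffeomorphic_imp_homeomorphic)
    then have "top_of_set (punctured_space (S r) e) homeomorphic_space top_of_set (punctured_space (S s) e)"
      unfolding M_def
      using homeomorphic_space_trans[OF homeomorphic_space_trans[OF transported_domain_homeomorphic[OF j, THEN homeomorphic_space_sym[THEN iffD1]]] transported_domain_homeomorphic[OF j]]
      by blast
    then show ?thesis using S_inj punctured_space_determines_set[OF eb S0 S0] by blast
  qed
  then have "inj (\<lambda>r. ?R `` {M r})" by (rule injI)
  moreover have "?R `` {M r} \<in> open_manifold_diffeo_classes" for r
    unfolding open_manifold_diffeo_classes_def using M by (intro quotientI) simp
  ultimately show ?thesis unfolding lepoll_def by (intro exI[of _ "\<lambda>r. ?R `` {M r}"]) auto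
qed

end
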